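(* There is an absolute constant $c > 0$ such that the following holds. Let $d \geq 2$, let $X = (\mathbb{R}^d, \|\cdot\|_X)$ be a symmetric norm with type-$2$ constant $T_2(X) \in [1,\infty)$, normalized so that $\|e_1\|_X = 1$, and let $\varepsilon \in (0,1)$. Then there exists a statistical algorithm for mean estimation over $X$ with error $\varepsilon$ that makes $3 d \log d$ queries to $\mathrm{STAT}(\alpha)$, where $$\alpha \geq c\, \frac{\varepsilon}{T_2(X) \cdot \log d \cdot \log(d/\varepsilon)}.$$
   Context: A norm $\|\cdot\|_X$ on $\mathbb{R}^d$ is symmetric if $\|x\|_X = \|x^*\|_X$ for all $x$, where $x^*$ is obtained from $x$ by taking absolute values of coordinates and sorting them in non-increasing order. The type-$2$ constant $T_2(X)$ is the smallest $T>0$ such that for every $n$ and all $x_1,\dots,x_n \in \mathbb{R}^d$, $\left(\mathbb{E}_{\varepsilon \sim \{-1,1\}^n} \|\sum_{i} \varepsilon_i x_i\|_X^2\right)^{1/2} \leq T \left(\sum_{i} \|x_i\|_X^2\right)^{1/2}$ ($\varepsilon$ uniform). For a distribution $P$ on a domain $\Omega$ and $\tau>0$, the oracle $\mathrm{STAT}(\tau)$ takes a query $h\colon \Omega \to [-1,1]$ and returns some (adversarially chosen) $v$ with $|v - \mathbb{E}_{x\sim P}[h(x)]| \leq \tau$. A statistical algorithm accesses the unknown distribution only through such an oracle. Mean estimation over $X$ with error $\varepsilon$: for every unknown distribution $P$ supported on the unit ball $B_X = \{x : \|x\|_X \leq 1\}$, the algorithm must output $\hat\mu \in \mathbb{R}^d$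 with $\|\hat\mu - \mathbb{E}_{x \sim P}[x]\|_X \leq \varepsilon$ with high probability (say at least $2/3$). $\log$ is base $2$. *)

theory Defs
  imports "HOL-Probability.Probability"
begin

text \<open>
  The dimension \<open>d\<close> varies inside the statement (the constant does not depend on it), so
  \<open>\<real>\<^sup>d\<close> is the set of real sequences vanishing from index \<open>d\<close> on. It inherits its Borel
  structure from the product topology on \<^typ>\<open>nat \<Rightarrow> real\<close>. Coordinates are numbered from 0,
  so \<open>e\<^sub>1\<close> is \<open>unit_vector 0\<close>.
\<close>

type_synonym vector = "nat \<Rightarrow> real"

definition Rn :: "nat \<Rightarrow> vector set" where
  "Rn d = {x. \<forall>i\<ge>d. x i = 0}"

definition unit_vector :: "nat \<Rightarrow> vector" where
  "unit_vector j = (\<lambda>i. if i = j then 1 else 0)"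

definition is_norm :: "nat \<Rightarrow> (vector \<Rightarrow> real) \<Rightarrow> bool" where
  "is_norm d N \<longleftrightarrow>
     (\<forall>x\<in>Rn d. 0 \<le> N x) \<and>
     (\<forall>x\<in>Rn d. N x = 0 \<longleftrightarrow> x = (\<lambda>_. 0)) \<and>
     (\<forall>a. \<forall>x\<in>Rn d. N (\<lambda>i. a * x i) = \<bar>a\<bar> * N x) \<and>
     (\<forall>x\<in>Rn d. \<forall>y\<in>Rn d. N (\<lambda>i. x i + y i) \<le> N x + N y)"

definition rearrangement :: "nat \<Rightarrow> vector \<Rightarrow> vector" where
  "rearrangement d x =
     (\<lambda>i. if i < d then rev (sort (map (\<lambda>j. \<bar>x j\<bar>) [0..<d])) ! i else 0)"

definition is_symmetric_norm :: "nat \<Rightarrow> (vector \<Rightarrow> real) \<Rightarrow> bool" where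
  "is_symmetric_norm d N \<longleftrightarrow> is_norm d N \<and> (\<forall>x\<in>Rn d. N x = N (rearrangement d x))"

definition type2_inequality :: "nat \<Rightarrow> (vector \<Rightarrow> real) \<Rightarrow> real \<Rightarrow> bool" where
  "type2_inequality d N T \<longleftrightarrow>
     (\<forall>(n::nat) (x :: nat \<Rightarrow> vector). (\<forall>i<n. x i \<in> Rn d) \<longrightarrow>
        sqrt (measure_pmf.expectation (pmf_of_set ({..<n} \<rightarrow>\<^sub>E {-1, 1 :: real}))
                (\<lambda>s. (N (\<lambda>j. \<Sum>i<n. s i * x i j))\<^sup>2))
        \<le> T * sqrt (\<Sum>i<n. (N (x i))\<^sup>2))"

definition is_type2_constant :: "nat \<Rightarrow> (vector \<Rightarrow> real) \<Rightarrow> real \<Rightarrow> bool" where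
  "is_type2_constant d N T \<longleftrightarrow>
     T > 0 \<and> type2_inequality d N T \<and> (\<forall>T'>0. type2_inequality d N T' \<longrightarrow> T \<le> T')"

definition unit_ball :: "nat \<Rightarrow> (vector \<Rightarrow> real) \<Rightarrow> vector set" where
  "unit_ball d N = {x \<in> Rn d. N x \<le> 1}"

text \<open>The measurable space \<open>M\<close> plays the role of the domain \<open>\<Omega>\<close>.\<close>

definition stat_queries :: "'x measure \<Rightarrow> ('x \<Rightarrow> real) set" where
  "stat_queries M = {h \<in> borel_measurable M. \<forall>x\<in>space M. -1 \<le> h x \<and> h x \<le> 1}"

text \<open>
  An oracle may choose its answer adversarially as a function of the whole transcript of earlier
  queries and answers and of the current query.
\<close>

type_synonym 'x transcript = "(('x \<Rightarrow> real) \<times> real) list"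
type_synonym 'x oracle_strategy = "'x transcript \<Rightarrow> ('x \<Rightarrow> real) \<Rightarrow> real"

definition STAT :: "'x measure \<Rightarrow> real \<Rightarrow> 'x oracle_strategy set" where
  "STAT P \<tau> =
     {orc. \<forall>tr. \<forall>h\<in>stat_queries P. \<bar>orc tr h - (\<integral>x. h x \<partial>P)\<bar> \<le> \<tau>}"

text \<open>
  An adaptive statistical algorithm, for fixed internal randomness: a decision tree that at each
  inner node asks a query and continues depending on the answer received.
\<close>

datatype ('x, 'y) stat_tree =
    Output 'y
  | Query "'x \<Rightarrow> real" "real \<Rightarrow> ('x, 'y) stat_tree"

primrec run :: "'x oracle_strategy \<Rightarrow> ('x, 'y) stat_tree \<Rightarrow> 'x transcript \<Rightarrow> 'y" where
  "run orc (Output y) tr = y"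
| "run orc (Query h k) tr = run orc (k (orc tr h)) (tr @ [(h, orc tr h)])"

text \<open>
  \<open>makes_queries M Y n t\<close>: every query of \<open>t\<close> is admissible on \<open>M\<close>, every output lies in \<open>Y\<close>, and
  at most \<open>n\<close> queries are made on every path.
\<close>

inductive makes_queries :: "'x measure \<Rightarrow> 'y set \<Rightarrow> nat \<Rightarrow> ('x, 'y) stat_tree \<Rightarrow> bool"
  for M Y where
  Output: "y \<in> Y \<Longrightarrow> makes_queries M Y n (Output y)"
| Query: "h \<in> stat_queries M \<Longrightarrow> (\<And>v. makes_queries M Y n (k v)) \<Longrightarrow>
            makes_queries M Y (Suc n) (Query h k)"

abbreviation ball_space :: "nat \<Rightarrow> (vector \<Rightarrow> real) \<Rightarrow> vector measure" where
  "ball_space d N \<equiv> restrict_space borel (unit_ball d N)"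

definition mean :: "vector measure \<Rightarrow> vector" where
  "mean P = (\<lambda>i. \<integral>x. x i \<partial>P)"

text \<open>
  A randomized algorithm draws a seed \<open>\<omega>\<close> from a probability space \<open>R\<close> of its choice and then runs
  the tree \<open>A \<omega>\<close>; the oracle sees \<open>\<omega>\<close> only through the queries. As the oracle strategy is
  arbitrary, the success event need not be measurable, so it is required to contain a measurable
  event of probability at least 2/3.
\<close>

definition mean_estimation_algorithm ::
  "nat \<Rightarrow> (vector \<Rightarrow> real) \<Rightarrow> real \<Rightarrow> nat \<Rightarrow> real \<Rightarrow>
   (nat \<Rightarrow> real) measure \<Rightarrow> ((nat \<Rightarrow> real) \<Rightarrow> (vector, vector) stat_tree) \<Rightarrow> bool" where
  "mean_estimation_algorithm d N \<epsilon> n \<tau> R A \<longleftrightarrow>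
     prob_space R \<and>
     (\<forall>\<omega>\<in>space R. makes_queries (ball_space d N) (Rn d) n (A \<omega>)) \<and>
     (\<forall>P. prob_space P \<and> sets P = sets (ball_space d N) \<longrightarrow>
        (\<forall>orc\<in>STAT P \<tau>. \<exists>E\<in>sets R. measure R E \<ge> 2 / 3 \<and>
           (\<forall>\<omega>\<in>E. N (\<lambda>i. run orc (A \<omega>) [] i - mean P i) \<le> \<epsilon>)))"

end

theory Submission
  imports Defs
begin

text \<open>
  Write \<open>\<phi> m\<close> for the norm of a 0-1 vector with \<open>m\<close> ones. A vector of the unit ball has fewer than
  \<open>m\<close> coordinates exceeding \<open>1 / \<phi> m\<close>, so clipping at the thresholds \<open>1 / \<phi> (4 ^ j)\<close> splits it into
  at most \<open>log\<^sub>2 d\<close> levels, the \<open>j\<close>-th having entries at most \<open>1 / \<phi> m\<close> and \<open>\<ell>\<^sub>2\<close>-norm at most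
  \<open>2 \<surd>m / \<phi> m\<close> for \<open>m = 4 ^ j\<close>. The mean of each level is estimated both in \<open>\<ell>\<^sub>\<infinity>\<close>, by \<open>d\<close> coordinate
  queries, and in \<open>\<ell>\<^sub>2\<close>, by fewer than \<open>2 d\<close> queries along the rows of a Hadamard matrix with randomly
  signed columns; random signs make these projections subexponential, so truncating them at a
  multiple of \<open>log (d / \<epsilon>)\<close> changes their expectations very little. Any vector consistent with the answers
  is then close to the true mean of the level, because the type-2 inequality bounds the norm of a
  vector \<open>e\<close> by a multiple of \<open>T \<cdot> \<phi> m \<cdot> b\<close> as soon as \<open>\<parallel>e\<parallel>\<^sub>\<infinity> \<le> b\<close> and \<open>\<parallel>e\<parallel>\<^sub>2 \<le> \<surd>m \<cdot> b\<close>. As also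
  \<open>\<parallel>e\<parallel> \<le> d \<cdot> \<parallel>e\<parallel>\<^sub>\<infinity>\<close>, one may replace \<open>T\<close> by \<open>min T d\<close>, which keeps the truncation level independent
  of \<open>T\<close>.
\<close>

subsection \<open>Symmetric norms\<close>

definition ind :: "nat set \<Rightarrow> vector" where
  "ind S = (\<lambda>i. if i \<in> S then 1 else 0)"

text \<open>On each block of length \<open>m\<close> the function is at least its value at the first
  index after the block. So the values at the block starts, apart from the first, are controlled by
  the full sum.\<close>

lemma sum_blocks_antimono:
  fixes f :: "nat \<Rightarrow> real"
  assumes "antimono f"
  shows "real m * (\<Sum>l<L. f (Suc l * m)) \<le> (\<Sum>i<L * m. f i)"
proof (induction L)
  case (Suc L)
  have "(\<Sum>i<Suc L * m. f i) = (\<Sum>i<L * m. f i) + (\<Sum>i=L*m..<L*m+m. f i)"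
    by (subst lessThan_atLeast0, subst sum.atLeastLessThan_concat[symmetric, of 0 "L*m"])
       (auto simp: lessThan_atLeast0 add.commute)
  moreover have "(\<Sum>i=L*m..<L*m+m. f (Suc L * m)) \<le> (\<Sum>i=L*m..<L*m+m. f i)"
    by (intro sum_mono antimonoD[OF assms]) auto
  ultimately show ?case
    using Suc by (simp add: algebra_simps)
qed simp

locale symmetric_norm =
  fixes d :: nat and N :: "vector \<Rightarrow> real"
  assumes sym: "is_symmetric_norm d N"
begin

lemma nonneg: "x \<in> Rn d \<Longrightarrow> 0 \<le> N x"
  and scale: "x \<in> Rn d \<Longrightarrow> N (\<lambda>i. a * x i) = \<bar>a\<bar> * N x"
  and triangle: "x \<in> Rn d \<Longrightarrow> y \<in> Rn d \<Longrightarrow> N (\<lambda>i. x i + y i) \<le> N x + N y"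
  and rearr: "x \<in> Rn d \<Longrightarrow> N (rearrangement d x) = N x"
  using sym by (auto simp: is_symmetric_norm_def is_norm_def)

lemma zero: "N (\<lambda>_. 0) = 0"
  using sym by (auto simp: is_symmetric_norm_def is_norm_def Rn_def)

lemma norm_sum_le:
  assumes "finite I" "\<And>k. k \<in> I \<Longrightarrow> f k \<in> Rn d"
  shows "N (\<lambda>i. \<Sum>k\<in>I. f k i) \<le> (\<Sum>k\<in>I. N (f k))"
  using assms
proof (induction I rule: finite_induct)
  case (insert k I)
  have "N (\<lambda>i. f k i + (\<Sum>k\<in>I. f k i)) \<le> N (f k) + N (\<lambda>i. \<Sum>k\<in>I. f k i)"
    using insert.prems by (intro triangle) (auto simp: Rn_def)
  with insert show ?case by auto
qed (simp add: zero)

text \<open>The decreasing rearrangement is determined by the multiset of absolute values, so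
  permutations and sign changes are handled together.\<close>

lemma mset_cong:
  assumes "x \<in> Rn d" "y \<in> Rn d"
    "image_mset (\<lambda>i. \<bar>x i\<bar>) (mset_set {..<d}) = image_mset (\<lambda>i. \<bar>y i\<bar>) (mset_set {..<d})"
  shows "N x = N y"
proof -
  have "mset (map (\<lambda>i. \<bar>x i\<bar>) [0..<d]) = mset (map (\<lambda>i. \<bar>y i\<bar>) [0..<d])"
    using assms(3) by (simp add: lessThan_atLeast0)
  then have "sort (map (\<lambda>i. \<bar>x i\<bar>) [0..<d]) = sort (map (\<lambda>i. \<bar>y i\<bar>) [0..<d])"
    by (intro properties_for_sort) auto
  then have "rearrangement d x = rearrangement d y"
    unfolding rearrangement_def by (simp only:)
  then show ?thesis
    using rearr assms by metis
qed

lemma abs_cong: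
  assumes "x \<in> Rn d" "y \<in> Rn d" "\<And>i. i < d \<Longrightarrow> \<bar>x i\<bar> = \<bar>y i\<bar>"
  shows "N x = N y"
  using assms by (intro mset_cong image_mset_cong) auto

text \<open>Shrinking one coordinate yields a convex combination of the vector and its reflection in
  that coordinate.\<close>

lemma shrink_coordinate:
  assumes x: "x \<in> Rn d" and j: "j < d" and a: "\<bar>a\<bar> \<le> \<bar>x j\<bar>"
  shows "N (x(j := a)) \<le> N x"
proof (cases "x j = 0")
  case True
  with a have "x(j := a) = x" by auto
  then show ?thesis by simp
next
  case False
  define l where "l = (1 + a / x j) / 2"
  have "\<bar>a / x j\<bar> \<le> 1"
    using a False by (simp add: abs_divide)
  then have "-1 \<le> a / x j" "a / x j \<le> 1"
    by linarith+
  then have l: "0 \<le> l" "l \<le> 1"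
    by (auto simp: l_def)
  define y where "y = x(j := - x j)"
  have y: "y \<in> Rn d" "N y = N x"
    using x j by (auto simp: y_def Rn_def intro!: abs_cong)
  have "a = l * x j + (1 - l) * (- x j)"
    using False by (simp add: l_def field_simps)
  then have "x(j := a) = (\<lambda>i. l * x i + (1 - l) * y i)"
    by (auto simp: y_def fun_eq_iff algebra_simps)
  moreover have "N (\<lambda>i. l * x i + (1 - l) * y i) \<le> N (\<lambda>i. l * x i) + N (\<lambda>i. (1 - l) * y i)"
    using x y by (intro triangle) (auto simp: Rn_def)
  ultimately show ?thesis
    using scale[OF x, of l] scale[OF y(1), of "1 - l"] l y(2) by (simp add: algebra_simps)
qed

text \<open>The coordinates of \<open>y\<close> are replaced by those of \<open>x\<close> one at a
  time; each replacement is an instance of \<open>shrink_coordinate\<close>.\<close>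

lemma mono:
  assumes x: "x \<in> Rn d" and y: "y \<in> Rn d" and le: "\<And>i. i < d \<Longrightarrow> \<bar>x i\<bar> \<le> \<bar>y i\<bar>"
  shows "N x \<le> N y"
proof -
  have "N (\<lambda>i. if i < k then x i else y i) \<le> N y" if "k \<le> d" for k
    using that
  proof (induction k)
    case (Suc k)
    let ?z = "\<lambda>i. if i < k then x i else y i"
    have "N (?z(k := x k)) \<le> N ?z"
      using Suc.prems x y le by (intro shrink_coordinate) (auto simp: Rn_def)
    moreover have "?z(k := x k) = (\<lambda>i. if i < Suc k then x i else y i)"
      by (auto simp: less_Suc_eq)
    ultimately show ?case
      using Suc by auto
  qed simp
  from this[of d] have "N (\<lambda>i. if i < d then x i else y i) \<le> N y" by simp
  moreover have "(\<lambda>i. if i < d then x i else y i) = x"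
    using x y by (auto simp: Rn_def fun_eq_iff)
  ultimately show ?thesis by simp
qed

definition \<phi> :: "nat \<Rightarrow> real" where
  "\<phi> m = N (ind {..<m})"

lemma ind_Rn: "S \<subseteq> {..<d} \<Longrightarrow> ind S \<in> Rn d"
  by (auto simp: ind_def Rn_def)

lemma norm_ind:
  assumes "S \<subseteq> {..<d}"
  shows "N (ind S) = \<phi> (card S)"
proof -
  have *: "image_mset (\<lambda>i. \<bar>ind A i\<bar>) (mset_set {..<d}) =
      replicate_mset (card A) 1 + replicate_mset (d - card A) 0" if "A \<subseteq> {..<d}" for A
  proof -
    have "mset_set {..<d} = mset_set A + mset_set ({..<d} - A)"
      using that by (subst mset_set_Union[symmetric]) (auto intro: finite_subset simp: Un_absorb1)
    moreover have "image_mset (\<lambda>i. \<bar>ind A i\<bar>) (mset_set A) = image_mset (\<lambda>_. 1) (mset_set A)"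
      using that by (intro image_mset_cong) (auto simp: ind_def dest: finite_subset)
    moreover have "image_mset (\<lambda>i. \<bar>ind A i\<bar>) (mset_set ({..<d} - A)) =
        image_mset (\<lambda>_. 0) (mset_set ({..<d} - A))"
      by (intro image_mset_cong) (auto simp: ind_def)
    moreover have "card ({..<d} - A) = d - card A"
      using that by (simp add: card_Diff_subset finite_subset)
    ultimately show ?thesis
      by (simp add: image_mset_const_eq)
  qed
  have c: "card S \<le> d"
    using card_mono[OF _ assms] by simp
  then have "{..<card S} \<subseteq> {..<d}" by auto
  then show ?thesis
    unfolding \<phi>_def using assms by (intro mset_cong) (auto intro: ind_Rn simp: *)
qed

lemma phi_mono: "a \<le> b \<Longrightarrow> b \<le> d \<Longrightarrow> \<phi> a \<le> \<phi> b"
  unfolding \<phi>_def by (intro mono ind_Rn) (auto simp: ind_def)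

lemma rearrangement_props:
  fixes x :: vector
  defines "r \<equiv> rearrangement d x"
  assumes x: "x \<in> Rn d"
  shows "r \<in> Rn d" "antimono r" "\<And>i. 0 \<le> r i" 
    "(\<Sum>i<d. (r i)\<^sup>2) = (\<Sum>i<d. (x i)\<^sup>2)"
    "\<And>b i. (\<And>j. j < d \<Longrightarrow> \<bar>x j\<bar> \<le> b) \<Longrightarrow> 0 \<le> b \<Longrightarrow> r i \<le> b"
proof -
  let ?L = "rev (sort (map (\<lambda>j. \<bar>x j\<bar>) [0..<d]))"
  have r: "r i = (if i < d then ?L ! i else 0)" for i
    by (simp add: r_def rearrangement_def)
  have mem: "?L ! i \<in> (\<lambda>j. \<bar>x j\<bar>) ` {..<d}" if "i < d" for i
    using nth_mem[of i ?L] that by auto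
  show "r \<in> Rn d" by (simp add: r Rn_def)
  show nn: "0 \<le> r i" for i
    using mem[of i] by (auto simp: r)
  show "r i \<le> b" if "\<And>j. j < d \<Longrightarrow> \<bar>x j\<bar> \<le> b" "0 \<le> b" for b i
    using mem[of i] that by (auto simp: r)
  show "antimono r"
  proof (rule antimonoI)
    fix i j :: nat
    assume "i \<le> j"
    show "r j \<le> r i"
    proof (cases "j < d")
      case True
      have "sorted (rev ?L)" by simp
      then have "?L ! j \<le> ?L ! i"
        using True \<open>i \<le> j\<close> by (intro sorted_rev_nth_mono) auto
      with True \<open>i \<le> j\<close> show ?thesis by (simp add: r)
    next
      case False
      with nn show ?thesis by (simp add: r)
    qed
  qed
  have "(\<Sum>i<d. (r i)\<^sup>2) = (\<Sum>i<d. (?L ! i)\<^sup>2)"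
    by (simp add: r)
  also have "\<dots> = sum_list (map (\<lambda>a. a\<^sup>2) ?L)"
    by (simp add: sum_list_sum_nth lessThan_atLeast0)
  also have "\<dots> = sum_mset (image_mset (\<lambda>a. a\<^sup>2) (mset ?L))"
    by (simp only: mset_map[symmetric] sum_mset_sum_list)
  also have "mset ?L = image_mset (\<lambda>j. \<bar>x j\<bar>) (mset_set {..<d})"
    by (simp add: lessThan_atLeast0)
  also have "sum_mset (image_mset (\<lambda>a. a\<^sup>2) \<dots>) = (\<Sum>i<d. (x i)\<^sup>2)"
    by (simp add: sum_unfold_sum_mset comp_def multiset.map_comp)
  finally show "(\<Sum>i<d. (r i)\<^sup>2) = (\<Sum>i<d. (x i)\<^sup>2)" .
qed

text \<open>The decreasing rearrangement is cut into blocks of length \<open>m\<close>. Random signs on the blocks do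
  not change the norm, so the type-2 inequality bounds it by the \<open>\<ell>\<^sub>2\<close>-sum of the norms of the
  blocks, and each block is dominated by its first entry times an indicator vector.\<close>

lemma norm_le_type2:
  assumes T: "type2_inequality d N T" "0 \<le> T"
    and e: "e \<in> Rn d" and m: "1 \<le> m" "m \<le> d"
    and b: "\<And>i. i < d \<Longrightarrow> \<bar>e i\<bar> \<le> b" and l2: "(\<Sum>i<d. (e i)\<^sup>2) \<le> real m * b\<^sup>2"
  shows "N e \<le> 2 * T * \<phi> m * b"
proof -
  define r where "r = rearrangement d e"
  note rp = rearrangement_props[OF e, folded r_def]
  have b0: "0 \<le> b" using b[of 0] m by (auto intro: order_trans[OF abs_ge_zero])
  have phi0: "0 \<le> \<phi> m" unfolding \<phi>_def using m by (intro nonneg ind_Rn) auto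
  \<comment> \<open>The blocks are indexed by all \<open>l < d\<close>. Those with
    \<open>l * m \<ge> d\<close> are zero, which spares computing the number of nonempty
    blocks.\<close>
  define x where "x l = (\<lambda>i. if i < d \<and> i div m = l then r i else 0)" for l
  have xR: "x l \<in> Rn d" for l
    by (auto simp: x_def Rn_def)
  let ?S = "{..<d} \<rightarrow>\<^sub>E {-1, 1 :: real}"
  have "N (\<lambda>j. \<Sum>i<d. s i * x i j) = N r" if s: "s \<in> ?S" for s
  proof (intro abs_cong)
    show "(\<lambda>j. \<Sum>i<d. s i * x i j) \<in> Rn d" "r \<in> Rn d"
      using xR rp(1) by (auto simp: Rn_def)
    fix j assume j: "j < d"
    have jm: "j div m < d"
      using j by (meson div_le_dividend le_less_trans)
    have "(\<Sum>i<d. s i * x i j) = (\<Sum>i<d. if i = j div m then s (j div m) * r j else 0)"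
      using j by (intro sum.cong) (auto simp: x_def)
    also have "\<dots> = s (j div m) * r j" using jm by simp
    moreover have "\<bar>s (j div m)\<bar> = 1"
      using PiE_mem[OF s, of "j div m"] jm by auto
    ultimately show "\<bar>\<Sum>i<d. s i * x i j\<bar> = \<bar>r j\<bar>"
      by (simp add: abs_mult)
  qed
  moreover have S: "finite ?S" "?S \<noteq> {}"
    by (auto intro!: finite_PiE simp: PiE_eq_empty_iff)
  ultimately have "measure_pmf.expectation (pmf_of_set ?S) (\<lambda>s. (N (\<lambda>j. \<Sum>i<d. s i * x i j))\<^sup>2)
      = (N r)\<^sup>2"
    by (subst integral_pmf_of_set) (auto simp: card_gt_0_iff)
  moreover have "sqrt (measure_pmf.expectation (pmf_of_set ?S) (\<lambda>s. (N (\<lambda>j. \<Sum>i<d. s i * x i j))\<^sup>2))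
      \<le> T * sqrt (\<Sum>i<d. (N (x i))\<^sup>2)"
    using T(1) xR unfolding type2_inequality_def by blast
  ultimately have 1: "N r \<le> T * sqrt (\<Sum>i<d. (N (x i))\<^sup>2)"
    using nonneg[OF rp(1)] by simp
  have 2: "N (x l) \<le> \<phi> m * r (l * m)" for l
  proof -
    let ?B = "{i. i < d \<and> i div m = l}"
    have "?B \<subseteq> {l * m..<l * m + m}"
    proof
      fix i assume "i \<in> ?B"
      then have "i div m = l" by simp
      moreover have "i = i div m * m + i mod m" by simp
      moreover have "i mod m < m" using m by simp
      ultimately show "i \<in> {l * m..<l * m + m}" by simp
    qed
    then have c: "card ?B \<le> m" using card_mono[of "{l * m..<l * m + m}" ?B] by simp
    have "N (x l) \<le> N (\<lambda>i. r (l * m) * ind ?B i)"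
    proof (intro mono xR)
      show "(\<lambda>i. r (l * m) * ind ?B i) \<in> Rn d" by (auto simp: Rn_def ind_def)
      fix i
      show "\<bar>x l i\<bar> \<le> \<bar>r (l * m) * ind ?B i\<bar>"
        using rp(3) antimonoD[OF rp(2), of "i div m * m" i] by (auto simp: x_def ind_def)
    qed
    also have "\<dots> = r (l * m) * \<phi> (card ?B)"
      using rp(3) by (subst scale) (auto intro: ind_Rn simp: norm_ind subset_eq)
    also have "\<dots> \<le> r (l * m) * \<phi> m"
      using rp(3) phi_mono[OF c m(2)] by (intro mult_left_mono) auto
    finally show ?thesis by (simp add: mult.commute)
  qed
  \<comment> \<open>The leading entry of block 0 is bounded only by \<open>b\<close>. The leading
    entry of any later block is at most every entry of the preceding block, so these are controlled
    by the l2-norm of \<open>r\<close>.\<close>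
  have "(\<Sum>l<d. (r (l * m))\<^sup>2) \<le> (\<Sum>l<Suc d. (r (l * m))\<^sup>2)"
    by simp
  also have "\<dots> = (r 0)\<^sup>2 + (\<Sum>l<d. (r (Suc l * m))\<^sup>2)"
    by (subst sum.lessThan_Suc_shift) simp
  also have "(\<Sum>l<d. (r (Suc l * m))\<^sup>2) \<le> b\<^sup>2"
  proof -
    have "antimono (\<lambda>i. (r i)\<^sup>2)"
      using rp(2,3) by (auto simp: antimono_def intro!: power_mono)
    from sum_blocks_antimono[OF this, of m d]
    have "real m * (\<Sum>l<d. (r (Suc l * m))\<^sup>2) \<le> (\<Sum>i<d * m. (r i)\<^sup>2)" .
    also have "\<dots> = (\<Sum>i<d. (r i)\<^sup>2)"
      using m rp(1) by (intro sum.mono_neutral_right) (auto simp: Rn_def)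
    also have "\<dots> \<le> real m * b\<^sup>2" using l2 rp(4) by simp
    finally show ?thesis using m by simp
  qed
  also have "(r 0)\<^sup>2 \<le> b\<^sup>2"
    using rp(3,5) b b0 by (intro power_mono) auto
  finally have "(\<Sum>l<d. (r (l * m))\<^sup>2) \<le> b\<^sup>2 + b\<^sup>2" by simp
  \<comment> \<open>Rounding 2 up to 4 makes the next bound the square of
    \<open>2 * \<phi> m * b\<close>.\<close>
  also have "\<dots> \<le> 4 * b\<^sup>2" by simp
  finally have 3: "(\<Sum>l<d. (r (l * m))\<^sup>2) \<le> 4 * b\<^sup>2" .
  have "(\<Sum>l<d. (N (x l))\<^sup>2) \<le> (\<Sum>l<d. (\<phi> m * r (l * m))\<^sup>2)"
    using 2 nonneg xR by (intro sum_mono power_mono) auto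
  also have "\<dots> = (\<phi> m)\<^sup>2 * (\<Sum>l<d. (r (l * m))\<^sup>2)"
    by (simp add: power_mult_distrib sum_distrib_left)
  also have "\<dots> \<le> (\<phi> m)\<^sup>2 * (4 * b\<^sup>2)"
    using 3 by (intro mult_left_mono) auto
  also have "\<dots> = (2 * \<phi> m * b)\<^sup>2" by (simp add: power2_eq_square)
  finally have "sqrt (\<Sum>l<d. (N (x l))\<^sup>2) \<le> 2 * \<phi> m * b"
    using phi0 b0 by (intro real_le_lsqrt) auto
  then have "T * sqrt (\<Sum>i<d. (N (x i))\<^sup>2) \<le> T * (2 * \<phi> m * b)"
    using T(2) by (rule mult_left_mono)
  with 1 rearr[OF e] show ?thesis by (simp add: r_def mult_ac)
qed

end

section \<open>Coordinates of vectors in the unit ball of a normalized norm\<close>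

locale normalized_symmetric_norm = symmetric_norm +
  assumes unit: "N (unit_vector 0) = 1"
begin

lemma phi_1: "\<phi> (Suc 0) = 1"
proof -
  have "ind {..<Suc 0} = unit_vector 0" by (auto simp: ind_def unit_vector_def)
  with unit show ?thesis by (simp add: \<phi>_def)
qed

lemma phi_ge_1: "1 \<le> m \<Longrightarrow> m \<le> d \<Longrightarrow> 1 \<le> \<phi> m"
  using phi_mono[of 1 m] by (simp add: phi_1)

text \<open>The triangle inequality over the coordinates, each basis vector having norm 1. This is
  the bound that wins when \<open>T\<close> exceeds the dimension.\<close>

lemma norm_le_dim:
  assumes e: "e \<in> Rn d" and b: "\<And>i. i < d \<Longrightarrow> \<bar>e i\<bar> \<le> b"
  shows "N e \<le> real d * b"
proof -
  have "N (\<lambda>i. e k * ind {k} i) \<le> b" if "k < d" for k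
    using that b[OF that] by (subst scale) (auto intro: ind_Rn simp: norm_ind phi_1)
  then have "(\<Sum>k<d. N (\<lambda>i. e k * ind {k} i)) \<le> (\<Sum>k<d. b)"
    by (intro sum_mono) auto
  moreover have "N (\<lambda>i. \<Sum>k<d. e k * ind {k} i) \<le> (\<Sum>k<d. N (\<lambda>i. e k * ind {k} i))"
    by (intro norm_sum_le) (auto simp: Rn_def ind_def)
  moreover have "(\<Sum>k<d. e k * ind {k} i) = e i" for i
  proof -
    have "(\<Sum>k<d. e k * ind {k} i) = (\<Sum>k<d. if k = i then e i else 0)"
      by (intro sum.cong) (auto simp: ind_def)
    with e show ?thesis by (auto simp: Rn_def)
  qed
  ultimately show ?thesis by simp
qed

text \<open>If \<open>m\<close> coordinates in a set \<open>S\<close> were larger, their minimum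
  \<open>a\<close> would exceed \<open>1 / \<phi> m\<close>, and \<open>x\<close> would dominate a
  multiple of an indicator with norm \<open>a * \<phi> m > 1\<close>.\<close>

lemma card_large_coordinates:
  assumes x: "x \<in> unit_ball d N" and m: "1 \<le> m" "m \<le> d"
  shows "card {i. i < d \<and> 1 / \<phi> m < \<bar>x i\<bar>} < m"
proof (rule ccontr)
  let ?L = "{i. i < d \<and> 1 / \<phi> m < \<bar>x i\<bar>}"
  assume "\<not> card ?L < m"
  then obtain S where S: "S \<subseteq> ?L" "card S = m"
    by (meson not_less obtain_subset_with_card_n)
  then have fS: "finite S" "S \<noteq> {}" using m by (auto intro: card_ge_0_finite)
  have Sd: "S \<subseteq> {..<d}" using S by auto
  have xR: "x \<in> Rn d" "N x \<le> 1" using x by (auto simp: unit_ball_def)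
  define a where "a = Min ((\<lambda>i. \<bar>x i\<bar>) ` S)"
  have a: "1 / \<phi> m < a" using fS S by (auto simp: a_def)
  have aS: "a \<le> \<bar>x i\<bar>" if "i \<in> S" for i using fS that by (auto simp: a_def)
  have p: "0 < \<phi> m" using phi_ge_1[OF m] by simp
  then have a0: "0 < a" using a by (meson less_trans zero_less_divide_1_iff)
  have "N (\<lambda>i. a * ind S i) \<le> N x"
    using aS a0 xR(1) Sd by (intro mono) (fastforce simp: Rn_def ind_def)+
  moreover have "N (\<lambda>i. a * ind S i) = a * \<phi> m"
    using Sd S a0 by (subst scale) (auto intro: ind_Rn simp: norm_ind)
  ultimately show False
    using a p xR by (simp add: field_simps)
qed

lemma coordinate_le_1:
  assumes x: "x \<in> unit_ball d N" 
  shows "\<bar>x i\<bar> \<le> 1"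
proof (cases "i < d")
  case True
  from card_large_coordinates[OF x, of 1] True show ?thesis
    by (auto simp: phi_1)
next
  case False
  with x show ?thesis by (auto simp: unit_ball_def Rn_def)
qed

end

subsection \<open>Hadamard matrices with random signs\<close>

text \<open>The Sylvester matrix of order \<open>2 ^ K\<close>: the entry is -1 to the number of
  positions among the \<open>K\<close> lowest binary digits where \<open>k\<close> and
  \<open>i\<close> both have a 1. The recursion removes the lowest digit.\<close>

fun hadamard :: "nat \<Rightarrow> nat \<Rightarrow> nat \<Rightarrow> real" where
  "hadamard 0 k i = 1"
| "hadamard (Suc K) k i =
     (if odd k \<and> odd i then - 1 else 1) * hadamard K (k div 2) (i div 2)"

lemma hadamard_abs: "\<bar>hadamard K k i\<bar> = 1"
  by (induction K arbitrary: k i) (auto simp: abs_mult)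

text \<open>Summing over the lowest digit of \<open>k\<close> gives a factor 2 or 0 according to
  whether \<open>i\<close> and \<open>j\<close> have equal parity; the remaining digits are left to
  the induction.\<close>

lemma hadamard_orthogonal:
  assumes "i < 2 ^ K" "j < 2 ^ K"
  shows "(\<Sum>k<2 ^ K. hadamard K k i * hadamard K k j) = (if i = j then 2 ^ K else 0)"
  using assms
proof (induction K arbitrary: i j)
  case (Suc K)
  let ?h = "hadamard K"
  have "(\<Sum>k<2 ^ Suc K. hadamard (Suc K) k i * hadamard (Suc K) k j) =
      (\<Sum>k<2 ^ K. \<Sum>b<2. hadamard (Suc K) (b + k * 2) i * hadamard (Suc K) (b + k * 2) j)"
    by (simp only: power_Suc mult.commute[of 2] sum_mult_product)
  also have "\<dots> = (\<Sum>k<2 ^ K. (1 + (if odd i \<noteq> odd j then -1 else 1)) *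
      (?h k (i div 2) * ?h k (j div 2)))"
  proof (intro sum.cong refl)
    fix k
    have "{..<2::nat} = {0, 1}" by auto
    then show "(\<Sum>b<2. hadamard (Suc K) (b + k * 2) i * hadamard (Suc K) (b + k * 2) j) =
        (1 + (if odd i \<noteq> odd j then -1 else 1)) * (?h k (i div 2) * ?h k (j div 2))"
      by simp
  qed
  also have "\<dots> = (1 + (if odd i \<noteq> odd j then -1 else 1)) *
      (\<Sum>k<2 ^ K. ?h k (i div 2) * ?h k (j div 2))"
    by (simp only: sum_distrib_left)
  also have "(\<Sum>k<2 ^ K. ?h k (i div 2) * ?h k (j div 2)) = (if i div 2 = j div 2 then 2 ^ K else 0)"
    using Suc.prems by (intro Suc.IH) auto
  also have "(1 + (if odd i \<noteq> odd j then -1 else 1)) * (if i div 2 = j div 2 then 2 ^ K else 0) =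
      (if i = j then 2 ^ Suc K else 0 :: real)"
  proof -
    have "i = j \<longleftrightarrow> i div 2 = j div 2 \<and> (odd i \<longleftrightarrow> odd j)" by presburger
    then show ?thesis by auto
  qed
  finally show ?case .
qed auto

text \<open>Only the first \<open>d\<close> columns enter, so \<open>d\<close> need not be a power
  of two. A uniform bound on the row projections thereby yields an l2-bound on
  \<open>e\<close>.\<close>

lemma hadamard_parseval:
  assumes d: "d \<le> 2 ^ K"
  shows "(\<Sum>k<2 ^ K. (\<Sum>i<d. e i * hadamard K k i)\<^sup>2) = 2 ^ K * (\<Sum>i<d. (e i)\<^sup>2)"
proof -
  have "(\<Sum>k<2 ^ K. (\<Sum>i<d. e i * hadamard K k i)\<^sup>2) =
      (\<Sum>k<2 ^ K. \<Sum>i<d. \<Sum>j<d. e i * e j * (hadamard K k i * hadamard K k j))"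
    by (simp add: power2_eq_square sum_product mult_ac)
  also have "\<dots> = (\<Sum>i<d. \<Sum>j<d. e i * e j * (\<Sum>k<2 ^ K. hadamard K k i * hadamard K k j))"
    by (subst sum.swap, rule sum.cong[OF refl], subst sum.swap) (simp add: sum_distrib_left)
  also have "\<dots> = (\<Sum>i<d. \<Sum>j<d. if i = j then e i * e i * 2 ^ K else 0)"
    using d by (intro sum.cong refl) (subst hadamard_orthogonal, auto)
  also have "\<dots> = (\<Sum>i<d. e i * e i * 2 ^ K)"
    by (intro sum.cong) auto
  finally show ?thesis
    by (simp add: power2_eq_square sum_distrib_left mult_ac)
qed

section \<open>Exponential moments and truncation of random signed sums\<close>

lemma exp_add_exp_minus_le:
  fixes c :: real
  assumes "\<bar>c\<bar> \<le> 1"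
  shows "exp c + exp (- c) \<le> 2 * exp (c\<^sup>2)"
proof -
  have *: "exp x + exp (- x) \<le> 2 * exp (x\<^sup>2)" if x: "0 \<le> x" "x \<le> 1" for x :: real
  proof -
    \<comment> \<open>The product equals \<open>1 + x ^ 3\<close>; bounding \<open>1 + x\<close> by
      \<open>exp x\<close> turns this into a quadratic upper bound for
      \<open>exp (- x)\<close>.\<close>
    have "1 \<le> (1 + x) * (1 - x + x\<^sup>2)"
      using x by (simp add: algebra_simps power2_eq_square power3_eq_cube)
    also have "\<dots> \<le> exp x * (1 - x + x\<^sup>2)"
      using x by (intro mult_right_mono) auto
    finally have "exp (- x) \<le> 1 - x + x\<^sup>2"
      by (simp add: exp_minus field_simps)
    moreover have "exp x \<le> 1 + x + x\<^sup>2"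
      using x by (intro exp_bound)
    moreover have "1 + x\<^sup>2 \<le> exp (x\<^sup>2)" by simp
    ultimately show ?thesis by linarith
  qed
  show ?thesis
    using *[of "\<bar>c\<bar>"] assms by (cases "0 \<le> c") (auto simp: add.commute)
qed

definition signs :: "nat \<Rightarrow> (nat \<Rightarrow> real) set" where
  "signs d = {..<d} \<rightarrow>\<^sub>E {-1, 1}"

lemma finite_signs: "finite (signs d)"
  unfolding signs_def by (intro finite_PiE) auto

lemma card_signs: "card (signs d) = 2 ^ d"
proof -
  have "card {-1, 1 :: real} = 2" by (subst card_insert_disjoint) simp_all
  moreover have "card (signs d) = (\<Prod>i<d. card {-1, 1 :: real})"
    unfolding signs_def by (rule card_PiE) simp
  ultimately show ?thesis by (simp only: prod_constant card_lessThan)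
qed

lemma signs_sq:
  assumes "s \<in> signs d" "i < d"
  shows "s i * s i = 1"
proof -
  have "s i \<in> {-1, 1}"
    using PiE_mem[of s "{..<d}" "\<lambda>_. {-1, 1}" i] assms unfolding signs_def by blast
  then consider "s i = -1" | "s i = 1" by blast
  then show ?thesis by cases simp_all
qed

text \<open>Independence of the signs appears as the factorization of a sum over a product set; each
  factor is a hyperbolic cosine, bounded by a Gaussian-type exponential.\<close>

lemma sum_signs_exp_le:
  assumes "\<And>i. i < d \<Longrightarrow> \<bar>c i\<bar> \<le> 1" "(\<Sum>i<d. (c i)\<^sup>2) \<le> 1"
  shows "(\<Sum>s\<in>signs d. exp (\<Sum>i<d. c i * s i)) \<le> 3 * 2 ^ d"
proof -
  have "(\<Sum>s\<in>signs d. exp (\<Sum>i<d. c i * s i)) = (\<Sum>s\<in>signs d. \<Prod>i<d. exp (c i * s i))"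
    by (simp add: exp_sum)
  also have "\<dots> = (\<Prod>i<d. \<Sum>b\<in>{-1, 1}. exp (c i * b))"
    unfolding signs_def by (subst prod_sum_PiE) auto
  also have "\<dots> \<le> (\<Prod>i<d. 2 * exp ((c i)\<^sup>2))"
    using exp_add_exp_minus_le[OF assms(1)]
    by (intro prod_mono) (auto simp: add.commute intro: add_nonneg_nonneg)
  also have "\<dots> = 2 ^ d * exp (\<Sum>i<d. (c i)\<^sup>2)"
    by (simp add: prod.distrib exp_sum)
  also have "\<dots> \<le> 2 ^ d * exp 1"
    using assms(2) by (intro mult_left_mono) auto
  also have "\<dots> \<le> 2 ^ d * 3"
    using exp_le by (intro mult_left_mono) auto
  finally show ?thesis by (simp add: mult.commute)
qed

definition clip :: "real \<Rightarrow> real \<Rightarrow> real" where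
  "clip t x = max (- t) (min t x)"

lemma clip_bounds: "0 \<le> t \<Longrightarrow> \<bar>clip t z\<bar> \<le> t"
  by (auto simp: clip_def)

lemma clip_id: "\<bar>z\<bar> \<le> t \<Longrightarrow> clip t z = z"
  by (auto simp: clip_def)

lemma clip_0: "clip 0 z = 0"
  by (auto simp: clip_def)

lemma clip_diff_bounds: "0 \<le> s \<Longrightarrow> s \<le> t \<Longrightarrow> \<bar>clip t z - clip s z\<bar> \<le> t - s"
  by (auto simp: clip_def)

lemma clip_diff_0: "s \<le> t \<Longrightarrow> \<bar>z\<bar> \<le> s \<Longrightarrow> clip t z - clip s z = 0"
  by (auto simp: clip_def)

text \<open>The excess \<open>\<bar>z\<bar> - t\<close> is at most its exponential, which reduces
  the truncation error to exponential moments of \<open>z\<close> and \<open>- z\<close>.\<close>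

lemma clip_error_le:
  assumes "0 \<le> t"
  shows "\<bar>z - clip t z\<bar> \<le> exp (- t) * (exp z + exp (- z))"
proof (cases "\<bar>z\<bar> \<le> t")
  case True
  then show ?thesis by (simp add: clip_id)
next
  case False
  then have "\<bar>z - clip t z\<bar> = \<bar>z\<bar> - t" using assms by (auto simp: clip_def)
  also have "\<dots> \<le> exp (\<bar>z\<bar> - t)" using exp_ge_add_one_self[of "\<bar>z\<bar> - t"] by linarith
  also have "\<dots> = exp (- t) * exp \<bar>z\<bar>" by (simp add: exp_diff exp_minus field_simps)
  also have "\<dots> \<le> exp (- t) * (exp z + exp (- z))"
    by (intro mult_left_mono) (cases "0 \<le> z", auto)
  finally show ?thesis .
qed

lemma clip_measurable [measurable]: "f \<in> borel_measurable M \<Longrightarrow> (\<lambda>x. clip t (f x)) \<in> borel_measurable M"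
  unfolding clip_def by (intro borel_measurable_max borel_measurable_min) auto

lemma sum_signs_clip_error_le:
  assumes "\<And>i. i < d \<Longrightarrow> \<bar>c i\<bar> \<le> 1" "(\<Sum>i<d. (c i)\<^sup>2) \<le> 1" "0 \<le> t"
  shows "(\<Sum>s\<in>signs d. \<bar>(\<Sum>i<d. c i * s i) - clip t (\<Sum>i<d. c i * s i)\<bar>) \<le> 2 ^ d * (6 * exp (- t))"
proof -
  let ?z = "\<lambda>s. \<Sum>i<d. c i * s i"
  have "(\<Sum>s\<in>signs d. \<bar>?z s - clip t (?z s)\<bar>)
      \<le> (\<Sum>s\<in>signs d. exp (- t) * (exp (?z s) + exp (- ?z s)))"
    using assms by (intro sum_mono clip_error_le)
  also have "\<dots> = exp (- t) * ((\<Sum>s\<in>signs d. exp (\<Sum>i<d. c i * s i)) +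
      (\<Sum>s\<in>signs d. exp (\<Sum>i<d. - c i * s i)))"
    by (simp add: sum_distrib_left sum.distrib distrib_left sum_negf)
  also have "\<dots> \<le> exp (- t) * (3 * 2 ^ d + 3 * 2 ^ d)"
    using assms by (intro mult_left_mono add_mono sum_signs_exp_le) auto
  finally show ?thesis by (simp add: mult_ac)
qed

subsection \<open>Non-adaptive algorithms\<close>

fun ask_all ::
  "'i list \<Rightarrow> ('i \<Rightarrow> 'x \<Rightarrow> real) \<Rightarrow> (('i \<Rightarrow> real) \<Rightarrow> 'y) \<Rightarrow> ('i \<Rightarrow> real) \<Rightarrow> ('x, 'y) stat_tree" where
  "ask_all [] q f a = Output (f a)"
| "ask_all (i # is) q f a = Query (q i) (\<lambda>v. ask_all is q f (a(i := v)))"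

lemma makes_queries_ask_all:
  assumes "\<And>a. f a \<in> Y" "\<And>i. i \<in> set is \<Longrightarrow> q i \<in> stat_queries M"
  shows "makes_queries M Y (length is) (ask_all is q f a)"
  using assms by (induction "is" arbitrary: a) (auto intro: makes_queries.intros)

text \<open>The oracle may react to the transcript, but each answer obeys the tolerance. Hence the
  output is \<open>f\<close> of some table of valid answers, and adversarial behaviour can be
  forgotten from here on.\<close>

lemma run_ask_all:
  assumes "orc \<in> STAT P \<tau>" "\<And>i. i \<in> set is \<Longrightarrow> q i \<in> stat_queries P"
  shows "\<exists>b. run orc (ask_all is q f a) tr = f b \<and>
    (\<forall>i\<in>set is. \<bar>b i - (\<integral>x. q i x \<partial>P)\<bar> \<le> \<tau>) \<and> (\<forall>i. i \<notin> set is \<longrightarrow> b i = a i)"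
  using assms(2)
proof (induction "is" arbitrary: a tr)
  case Nil
  show ?case by (intro exI[of _ a]) simp
next
  case (Cons i "is")
  let ?v = "orc tr (q i)"
  have v: "\<bar>?v - (\<integral>x. q i x \<partial>P)\<bar> \<le> \<tau>"
    using assms(1) Cons.prems by (auto simp: STAT_def)
  have "\<exists>b. run orc (ask_all is q f (a(i := ?v))) (tr @ [(q i, ?v)]) = f b \<and>
      (\<forall>i\<in>set is. \<bar>b i - (\<integral>x. q i x \<partial>P)\<bar> \<le> \<tau>) \<and>
      (\<forall>k. k \<notin> set is \<longrightarrow> b k = (a(i := ?v)) k)"
    using Cons.prems by (intro Cons.IH) auto
  then obtain b where b: "run orc (ask_all is q f (a(i := ?v))) (tr @ [(q i, ?v)]) = f b"
    "\<forall>i\<in>set is. \<bar>b i - (\<integral>x. q i x \<partial>P)\<bar> \<le> \<tau>"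
    "\<forall>k. k \<notin> set is \<longrightarrow> b k = (a(i := ?v)) k"
    by blast
  \<comment> \<open>If \<open>i\<close> recurs in the list, the later answer overwrites this one and
    is valid as well.\<close>
  have "\<bar>b i - (\<integral>x. q i x \<partial>P)\<bar> \<le> \<tau>"
    using b(2,3) v by (cases "i \<in> set is") auto
  with b show ?case by (intro exI[of _ b]) auto
qed

text \<open>Markov's inequality by counting: every bad element contributes at least
  \<open>\<delta>\<close> to the sum, so at most a third of \<open>S\<close> is bad.\<close>

lemma markov_pmf_of_set:
  fixes g :: "'a \<Rightarrow> real"
  assumes S: "finite S" "S \<noteq> {}" and g: "\<And>s. s \<in> S \<Longrightarrow> 0 \<le> g s"
    and sum: "(\<Sum>s\<in>S. g s) \<le> real (card S) * (\<delta> / 3)" and \<delta>: "0 < \<delta>"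
  shows "measure (measure_pmf (pmf_of_set S)) {s \<in> S. g s \<le> \<delta>} \<ge> 2 / 3"
proof -
  let ?B = "{s \<in> S. \<not> g s \<le> \<delta>}"
  have "real (card ?B) * \<delta> = (\<Sum>s\<in>?B. \<delta>)" by simp
  also have "\<dots> \<le> (\<Sum>s\<in>?B. g s)" by (intro sum_mono) auto
  also have "\<dots> \<le> (\<Sum>s\<in>S. g s)" using S g by (intro sum_mono2) auto
  also note sum
  finally have "real (card ?B) \<le> real (card S) / 3"
    using \<delta> by (simp add: field_simps)
  moreover have "card S = card {s \<in> S. g s \<le> \<delta>} + card ?B"
    using S by (subst card_Un_disjoint[symmetric]) (auto intro: arg_cong[where f = card])
  ultimately have "2 / 3 * real (card S) \<le> real (card {s \<in> S. g s \<le> \<delta>})"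
    by linarith
  moreover have "0 < card S" using S by (simp add: card_gt_0_iff)
  moreover have "S \<inter> {s \<in> S. g s \<le> \<delta>} = {s \<in> S. g s \<le> \<delta>}" by auto
  ultimately show ?thesis
    using S by (simp add: measure_pmf_of_set field_simps)
qed

subsection \<open>Decomposition into levels\<close>

lemma four_power: "(4::real) ^ j = (2 ^ j)\<^sup>2"
  by (simp add: power2_eq_square flip: power_mult_distrib)

context normalized_symmetric_norm
begin

text \<open>The value 0 for \<open>4 ^ j > d\<close> lets the last level absorb all remaining small coordinates.\<close>

definition \<theta> :: "nat \<Rightarrow> real" where
  "\<theta> j = (if 4 ^ j \<le> d then 1 / \<phi> (4 ^ j) else 0)"

text \<open>The part of each coordinate lying at heights between \<open>\<theta> (Suc j)\<close> and
  \<open>\<theta> j\<close>, with its sign.\<close>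

definition level :: "nat \<Rightarrow> vector \<Rightarrow> vector" where
  "level j x = (\<lambda>i. clip (\<theta> j) (x i) - clip (\<theta> (Suc j)) (x i))"

lemma theta_nonneg: "0 \<le> \<theta> j"
  using phi_ge_1[of "4 ^ j"] by (auto simp: \<theta>_def)

lemma theta_le_1: "\<theta> j \<le> 1"
  using phi_ge_1[of "4 ^ j"] by (auto simp: \<theta>_def)

lemma theta_pos: "4 ^ j \<le> d \<Longrightarrow> 0 < \<theta> j"
  using phi_ge_1[of "4 ^ j"] by (auto simp: \<theta>_def)

lemma theta_Suc_le: "\<theta> (Suc j) \<le> \<theta> j"
proof (cases "4 ^ Suc j \<le> d")
  case True
  then have "4 ^ j \<le> d" by simp
  moreover have "\<phi> (4 ^ j) \<le> \<phi> (4 ^ Suc j)"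
    using True by (intro phi_mono) auto
  ultimately show ?thesis
    using True phi_ge_1[of "4 ^ j"] by (auto simp: \<theta>_def intro!: divide_left_mono)
next
  case False
  then show ?thesis using theta_nonneg[of j] by (simp add: \<theta>_def)
qed

lemma level_abs_le: "\<bar>level j x i\<bar> \<le> \<theta> j"
  using clip_diff_bounds[OF theta_nonneg theta_Suc_le, of j "x i"] theta_nonneg[of "Suc j"]
  by (simp add: level_def)

lemma level_measurable:
  assumes "sets M = sets (ball_space d N)"
  shows "(\<lambda>x. level j x i) \<in> borel_measurable M"
  unfolding level_def
  by (subst measurable_cong_sets[OF assms refl], rule measurable_restrict_space1)
     (intro borel_measurable_diff clip_measurable measurable_product_coordinates)

lemma level_beyond: "x \<in> unit_ball d N \<Longrightarrow> d \<le> i \<Longrightarrow> level j x i = 0"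
  using theta_nonneg by (auto simp: level_def unit_ball_def Rn_def clip_def)

text \<open>The sum telescopes from the threshold 1, which clips no coordinate of a vector in the
  unit ball, down to the threshold 0.\<close>

lemma sum_level:
  assumes "x \<in> unit_ball d N" "d < 4 ^ J" "1 \<le> d"
  shows "(\<Sum>j<J. level j x i) = x i"
proof -
  have "\<theta> 0 = 1" "\<theta> J = 0"
    using assms by (auto simp: \<theta>_def phi_1)
  moreover have "(\<Sum>j<J. level j x i) = clip (\<theta> 0) (x i) - clip (\<theta> J) (x i)"
    unfolding level_def by (rule sum_lessThan_telescope')
  ultimately show ?thesis
    using coordinate_le_1[OF assms(1)] by (simp add: clip_0 clip_id)
qed

text \<open>Only coordinates exceeding \<open>\<theta> (Suc j)\<close> contribute, each at most
  \<open>\<theta> j\<close>. There are at most \<open>4 ^ Suc j\<close> of them: by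
  \<open>card_large_coordinates\<close>, or trivially when \<open>4 ^ Suc j\<close> exceeds
  \<open>d\<close>.\<close>

lemma sum_level_sq_le:
  assumes x: "x \<in> unit_ball d N"
  shows "(\<Sum>i<d. (level j x i)\<^sup>2) \<le> (2 * 2 ^ j * \<theta> j)\<^sup>2"
proof -
  define L where "L = {i. i < d \<and> \<theta> (Suc j) < \<bar>x i\<bar>}"
  have "card L \<le> 4 ^ Suc j"
  proof (cases "4 ^ Suc j \<le> d")
    case True
    then show ?thesis
      using card_large_coordinates[OF x, of "4 ^ Suc j"] by (simp add: L_def \<theta>_def)
  next
    case False
    have "card L \<le> card {..<d}" by (intro card_mono) (auto simp: L_def)
    with False show ?thesis by simp
  qed
  then have L: "real (card L) \<le> 4 ^ Suc j"
    by (metis of_nat_le_iff of_nat_numeral of_nat_power)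
  have "level j x i = 0" if "i \<in> {..<d} - L" for i
    using that clip_diff_0[OF theta_Suc_le, of "x i" j] by (auto simp: L_def level_def)
  then have "(\<Sum>i<d. (level j x i)\<^sup>2) = (\<Sum>i\<in>L. (level j x i)\<^sup>2)"
    by (intro sum.mono_neutral_right) (auto simp: L_def)
  also have "\<dots> \<le> (\<Sum>i\<in>L. (\<theta> j)\<^sup>2)"
    using level_abs_le theta_nonneg by (intro sum_mono) (simp add: abs_le_square_iff[symmetric])
  also have "\<dots> \<le> 4 ^ Suc j * (\<theta> j)\<^sup>2"
    using L by (simp add: mult_right_mono)
  also have "(4::real) ^ Suc j = (2 * 2 ^ j)\<^sup>2"
    by (simp add: four_power power_mult_distrib)
  finally show ?thesis by (simp add: power_mult_distrib)
qed

text \<open>The signs do not affect squares, so Parseval turns the row bounds into the l2-hypothesis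
  of \<open>norm_le_type2\<close> with \<open>m = 4 ^ j\<close>. There \<open>\<phi> m\<close>
  cancels against \<open>\<theta> j\<close>.\<close>

lemma level_error:
  assumes T: "type2_inequality d N T" "0 \<le> T" and e: "e \<in> Rn d"
    and j: "4 ^ j \<le> d" and K: "d \<le> 2 ^ K" and s: "s \<in> signs d" and b: "0 \<le> b"
    and e1: "\<And>i. i < d \<Longrightarrow> \<bar>e i\<bar> \<le> \<theta> j * b"
    and e2: "\<And>k. k < 2 ^ K \<Longrightarrow> \<bar>\<Sum>i<d. e i * s i * hadamard K k i\<bar> \<le> 2 ^ j * \<theta> j * b"
  shows "N e \<le> 2 * min T (real d) * b"
proof -
  have "2 ^ K * (\<Sum>i<d. (e i)\<^sup>2) = 2 ^ K * (\<Sum>i<d. (e i * s i)\<^sup>2)"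
    using signs_sq[OF s] by (simp add: power_mult_distrib power2_eq_square[of "s _"])
  also have "\<dots> = (\<Sum>k<2 ^ K. (\<Sum>i<d. e i * s i * hadamard K k i)\<^sup>2)"
    by (rule hadamard_parseval[OF K, symmetric])
  also have "\<dots> \<le> (\<Sum>k<(2::nat) ^ K. (2 ^ j * \<theta> j * b)\<^sup>2)"
    using e2 theta_nonneg b
    by (intro sum_mono) (auto simp: abs_le_square_iff[symmetric] abs_mult)
  also have "\<dots> = 2 ^ K * (2 ^ j * \<theta> j * b)\<^sup>2" by simp
  finally have "(\<Sum>i<d. (e i)\<^sup>2) \<le> (2 ^ j * \<theta> j * b)\<^sup>2" by simp
  also have "\<dots> = real (4 ^ j) * (\<theta> j * b)\<^sup>2"
    by (simp add: four_power power_mult_distrib)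
  finally have "N e \<le> 2 * T * \<phi> (4 ^ j) * (\<theta> j * b)"
    using T e j e1 by (intro norm_le_type2) auto
  also have "\<dots> = 2 * T * b"
    using j phi_ge_1[of "4 ^ j"] by (simp add: \<theta>_def)
  finally have 1: "N e \<le> 2 * T * b" .
  have "N e \<le> real d * (\<theta> j * b)"
    using e e1 by (rule norm_le_dim)
  also have "\<dots> \<le> real d * (1 * b)"
    using theta_le_1 b by (intro mult_left_mono mult_right_mono) auto
  also have "\<dots> \<le> 2 * real d * b" using b by simp
  finally show ?thesis using 1 by (simp add: min_def)
qed

end

subsection \<open>The estimator\<close>

text \<open>\<open>trunc\<close> is the hypothesis of Markov's inequality for the truncation error
  summed over all levels and rows; \<open>total\<close> adds up the errors of the \<open>J\<close>
  levels.\<close>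

locale sq_mean_estimation = normalized_symmetric_norm +
  fixes K J :: nat and t \<alpha> T \<epsilon> :: real
  assumes d1: "1 \<le> d" and dK: "d \<le> 2 ^ K"
    and low: "j < J \<Longrightarrow> 4 ^ j \<le> d" and dJ: "d < 4 ^ J"
    and t1: "1 \<le> t" and \<alpha>0: "0 < \<alpha>"
    and type2: "type2_inequality d N T" and T0: "0 < T"
    and trunc: "real J * 2 ^ K * (6 * exp (- t)) \<le> t * \<alpha> / 3"
    and total: "real J * (16 * min T (real d) * (t * \<alpha>)) \<le> \<epsilon>"
begin

text \<open>The divisor is the l2-bound of \<open>sum_level_sq_le\<close>, so the coefficients of
  the signs have l2-norm at most 1.\<close>

definition proj :: "vector \<Rightarrow> nat \<Rightarrow> nat \<Rightarrow> vector \<Rightarrow> real" where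
  "proj s j k x = (\<Sum>i<d. level j x i / (2 * 2 ^ j * \<theta> j) * hadamard K k i * s i)"

definition query :: "vector \<Rightarrow> nat \<times> nat \<Rightarrow> vector \<Rightarrow> real" where
  "query s = (\<lambda>(j, k) x.
     if k < d then level j x k / \<theta> j else clip t (proj s j (k - d) x) / t)"

definition indices :: "(nat \<times> nat) list" where
  "indices = List.product [0..<J] [0..<d + 2 ^ K]"

text \<open>The slacks are those that the true mean of a level meets: the rescaled tolerance for
  coordinates, and twice the rescaled tolerance for Hadamard rows, to leave room for truncation.
  Only the seed and the answers enter, never the unknown distribution.\<close>

definition consistent :: "vector \<Rightarrow> (nat \<times> nat \<Rightarrow> real) \<Rightarrow> nat \<Rightarrow> vector \<Rightarrow> bool" where
  "consistent s a j v \<longleftrightarrow> v \<in> Rn d \<and>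
     (\<forall>i<d. \<bar>v i - \<theta> j * a (j, i)\<bar> \<le> \<theta> j * \<alpha>) \<and>
     (\<forall>k<2 ^ K. \<bar>(\<Sum>i<d. v i * s i * hadamard K k i) - 2 * 2 ^ j * \<theta> j * (t * a (j, d + k))\<bar>
        \<le> 4 * 2 ^ j * \<theta> j * (t * \<alpha>))"

text \<open>If the answers are not consistent with any vector, the choice operator returns junk; the
  case distinction keeps the output in \<open>Rn d\<close> even then.\<close>

definition estimate :: "vector \<Rightarrow> (nat \<times> nat \<Rightarrow> real) \<Rightarrow> vector" where
  "estimate s a = (\<lambda>i. if i < d then \<Sum>j<J. (SOME v. consistent s a j v) i else 0)"

definition algorithm :: "vector \<Rightarrow> (vector, vector) stat_tree" where
  "algorithm s = ask_all indices (query s) (estimate s) (\<lambda>_. 0)"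

text \<open>Both vectors are compared with the same answers, so their difference obeys twice the
  slacks, and \<open>level_error\<close> applies with \<open>b = 8 * (t * \<alpha>)\<close>.\<close>

lemma consistent_close:
  assumes s: "s \<in> signs d" and j: "j < J" and v: "consistent s a j v" and w: "consistent s a j w"
  shows "N (\<lambda>i. v i - w i) \<le> 16 * min T (real d) * (t * \<alpha>)"
proof -
  have ta: "\<alpha> \<le> t * \<alpha>" using t1 \<alpha>0 by simp
  have "N (\<lambda>i. v i - w i) \<le> 2 * min T (real d) * (8 * (t * \<alpha>))"
  proof (rule level_error[OF type2 _ _ low[OF j] dK s])
    show "0 \<le> T" "0 \<le> 8 * (t * \<alpha>)" "(\<lambda>i. v i - w i) \<in> Rn d"
      using T0 t1 \<alpha>0 v w by (auto simp: consistent_def Rn_def)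
    show "\<bar>v i - w i\<bar> \<le> \<theta> j * (8 * (t * \<alpha>))" if "i < d" for i
    proof -
      have "\<bar>v i - \<theta> j * a (j, i)\<bar> \<le> \<theta> j * \<alpha>" "\<bar>w i - \<theta> j * a (j, i)\<bar> \<le> \<theta> j * \<alpha>"
        using v w that by (auto simp: consistent_def)
      then have "\<bar>v i - w i\<bar> \<le> \<theta> j * (2 * \<alpha>)" by linarith
      also have "\<dots> \<le> \<theta> j * (8 * (t * \<alpha>))"
        using theta_nonneg ta \<alpha>0 by (intro mult_left_mono) auto
      finally show ?thesis .
    qed
    show "\<bar>\<Sum>i<d. (v i - w i) * s i * hadamard K k i\<bar> \<le> 2 ^ j * \<theta> j * (8 * (t * \<alpha>))"
      if "k < 2 ^ K" for k
    proof -
      let ?c = "2 * 2 ^ j * \<theta> j * (t * a (j, d + k))"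
      have "\<bar>(\<Sum>i<d. v i * s i * hadamard K k i) - ?c\<bar> \<le> 4 * 2 ^ j * \<theta> j * (t * \<alpha>)"
        "\<bar>(\<Sum>i<d. w i * s i * hadamard K k i) - ?c\<bar> \<le> 4 * 2 ^ j * \<theta> j * (t * \<alpha>)"
        using v w that by (auto simp: consistent_def)
      moreover have "(\<Sum>i<d. (v i - w i) * s i * hadamard K k i) =
          (\<Sum>i<d. v i * s i * hadamard K k i) - (\<Sum>i<d. w i * s i * hadamard K k i)"
        by (simp add: left_diff_distrib sum_subtractf)
      ultimately show ?thesis by linarith
    qed
  qed
  then show ?thesis by simp
qed

lemma query_stat_query:
  assumes M: "sets M = sets (ball_space d N)" and p: "p \<in> set indices"
  shows "query s p \<in> stat_queries M"
proof -
  obtain j k where jk: "p = (j, k)" "j < J"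
    using p by (auto simp: indices_def)
  have m: "(\<lambda>x. level j x i) \<in> borel_measurable M" for i
    by (rule level_measurable[OF M])
  have pm: "(\<lambda>x. proj s j i x) \<in> borel_measurable M" for i
    unfolding proj_def using m by (intro borel_measurable_sum borel_measurable_times borel_measurable_divide) auto
  have "query s p \<in> borel_measurable M"
    using m pm by (cases "k < d") (auto simp: query_def jk intro!: borel_measurable_divide clip_measurable)
  moreover have "\<bar>query s p x\<bar> \<le> 1" for x
    using level_abs_le[of j x k] theta_pos[OF low[OF jk(2)]] clip_bounds[of t "proj s j (k - d) x"] t1
    by (auto simp: query_def jk abs_divide)
  ultimately show ?thesis
    by (simp add: stat_queries_def abs_le_iff minus_le_iff)
qed

section \<open>Analysis for a fixed distribution\<close>

context
  fixes P :: "vector measure"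
  assumes prob: "prob_space P" and sets: "sets P = sets (ball_space d N)"
begin

interpretation prob_space P by (rule prob)

definition truncation_error :: "vector \<Rightarrow> nat \<Rightarrow> nat \<Rightarrow> real" where
  "truncation_error s j k = (\<integral>x. \<bar>proj s j k x - clip t (proj s j k x)\<bar> \<partial>P)"

lemma space_P: "space P = unit_ball d N"
  using sets_eq_imp_space_eq[OF sets] by (simp add: space_restrict_space)

lemma level_integrable: "integrable P (\<lambda>x. level j x i)"
  using level_measurable[OF sets] level_abs_le by (intro integrable_const_bound[where B = "\<theta> j"]) auto

lemma proj_integrable: "integrable P (proj s j k)"
  unfolding proj_def using level_integrable by (intro Bochner_Integration.integrable_sum) auto

lemma clip_integrable: "integrable P f \<Longrightarrow> integrable P (\<lambda>x. clip t (f x))"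
  using t1 clip_bounds[of t] by (intro integrable_const_bound[where B = t] clip_measurable) auto

text \<open>For each fixed \<open>x\<close> the sum over the signs is small by
  \<open>sum_signs_clip_error_le\<close>; the finite sum is then exchanged with the
  integral.\<close>

lemma sum_signs_truncation_error_le:
  assumes j: "j < J"
  shows "(\<Sum>s\<in>signs d. truncation_error s j k) \<le> 2 ^ d * (6 * exp (- t))"
proof -
  let ?c = "\<lambda>x i. level j x i / (2 * 2 ^ j * \<theta> j) * hadamard K k i"
  have int: "integrable P (\<lambda>x. \<bar>proj s j k x - clip t (proj s j k x)\<bar>)" for s
    using proj_integrable by (intro integrable_abs Bochner_Integration.integrable_diff clip_integrable)
  have "(\<Sum>s\<in>signs d. \<bar>proj s j k x - clip t (proj s j k x)\<bar>) \<le> 2 ^ d * (6 * exp (- t))"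
    if x: "x \<in> space P" for x
    unfolding proj_def
  proof (rule sum_signs_clip_error_le)
    have \<theta>: "0 < \<theta> j" using j by (intro theta_pos low)
    have sq: "(hadamard K k i)\<^sup>2 = 1" for i
      using hadamard_abs[of K k i] by (metis power2_abs power_one)
    have "(\<Sum>i<d. (?c x i)\<^sup>2) = (\<Sum>i<d. (level j x i)\<^sup>2) / (2 * 2 ^ j * \<theta> j)\<^sup>2"
      by (simp add: power_mult_distrib power_divide sq sum_divide_distrib)
    also have "\<dots> \<le> 1"
      using sum_level_sq_le[of x j] x \<theta> by (simp add: space_P divide_le_eq_1)
    finally show "(\<Sum>i<d. (?c x i)\<^sup>2) \<le> 1" .
    then have "(?c x i)\<^sup>2 \<le> 1" if "i < d" for i
      using member_le_sum[of i "{..<d}" "\<lambda>i. (?c x i)\<^sup>2"] that by auto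
    then show "\<bar>?c x i\<bar> \<le> 1" if "i < d" for i
      using that by (simp only: abs_square_le_1)
    show "0 \<le> t" using t1 by simp
  qed
  then have "(\<integral>x. (\<Sum>s\<in>signs d. \<bar>proj s j k x - clip t (proj s j k x)\<bar>) \<partial>P)
      \<le> 2 ^ d * (6 * exp (- t))"
    using int by (intro integral_le_const AE_I2 Bochner_Integration.integrable_sum) auto
  then show ?thesis
    unfolding truncation_error_def using int by (subst Bochner_Integration.integral_sum[symmetric]) auto
qed

text \<open>This event depends on the distribution but not on the oracle, so one event serves every
  adversarial strategy.\<close>

definition good_seeds :: "vector set" where
  "good_seeds = {s \<in> signs d. (\<Sum>j<J. \<Sum>k<2 ^ K. truncation_error s j k) \<le> t * \<alpha>}"

lemma truncation_error_nonneg: "0 \<le> truncation_error s j k"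
  by (simp add: truncation_error_def)

lemma prob_good_seeds: "measure (measure_pmf (pmf_of_set (signs d))) good_seeds \<ge> 2 / 3"
  unfolding good_seeds_def
proof (rule markov_pmf_of_set)
  show "finite (signs d)" by (rule finite_signs)
  have "0 < card (signs d)" by (simp add: card_signs)
  then show "signs d \<noteq> {}" by auto
  show "0 < t * \<alpha>" using t1 \<alpha>0 by simp
  show "0 \<le> (\<Sum>j<J. \<Sum>k<2 ^ K. truncation_error s j k)" for s
    by (intro sum_nonneg truncation_error_nonneg)
  have "(\<Sum>s\<in>signs d. \<Sum>j<J. \<Sum>k<2 ^ K. truncation_error s j k) =
      (\<Sum>j<J. \<Sum>k<2 ^ K. \<Sum>s\<in>signs d. truncation_error s j k)"
    by (subst sum.swap, rule sum.cong[OF refl], subst sum.swap) simp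
  also have "\<dots> \<le> (\<Sum>j<J. \<Sum>k<(2::nat) ^ K. 2 ^ d * (6 * exp (- t)))"
    by (intro sum_mono sum_signs_truncation_error_le) auto
  also have "\<dots> = 2 ^ d * (real J * 2 ^ K * (6 * exp (- t)))"
    by simp
  also have "\<dots> \<le> 2 ^ d * (t * \<alpha> / 3)"
    using trunc by (intro mult_left_mono) auto
  finally show "(\<Sum>s\<in>signs d. \<Sum>j<J. \<Sum>k<2 ^ K. truncation_error s j k)
      \<le> real (card (signs d)) * (t * \<alpha> / 3)"
    by (simp add: card_signs)
qed

lemma consistent_mean:
  assumes s: "s \<in> good_seeds" and j: "j < J"
    and a: "\<And>p. p \<in> set indices \<Longrightarrow> \<bar>a p - (\<integral>x. query s p x \<partial>P)\<bar> \<le> \<alpha>"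
  shows "consistent s a j (\<lambda>i. \<integral>x. level j x i \<partial>P)"
  unfolding consistent_def
proof (intro conjI allI impI)
  have \<theta>: "0 < \<theta> j" using j by (intro theta_pos low)
  show "(\<lambda>i. \<integral>x. level j x i \<partial>P) \<in> Rn d"
  proof -
    have "(\<integral>x. level j x i \<partial>P) = (\<integral>x. 0 \<partial>P)" if "d \<le> i" for i
      using that by (intro Bochner_Integration.integral_cong) (auto simp: space_P level_beyond)
    then show ?thesis by (simp add: Rn_def)
  qed
  show "\<bar>(\<integral>x. level j x i \<partial>P) - \<theta> j * a (j, i)\<bar> \<le> \<theta> j * \<alpha>" if "i < d" for i
  proof -
    have "\<bar>a (j, i) - (\<integral>x. level j x i \<partial>P) / \<theta> j\<bar> \<le> \<alpha>"
      using a[of "(j, i)"] j that by (auto simp: indices_def query_def)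
    then have "\<theta> j * \<bar>a (j, i) - (\<integral>x. level j x i \<partial>P) / \<theta> j\<bar> \<le> \<theta> j * \<alpha>"
      using \<theta> by (intro mult_left_mono) auto
    also have "\<theta> j * \<bar>a (j, i) - (\<integral>x. level j x i \<partial>P) / \<theta> j\<bar> =
        \<bar>\<theta> j * (a (j, i) - (\<integral>x. level j x i \<partial>P) / \<theta> j)\<bar>"
      using \<theta> by (simp add: abs_mult)
    also have "\<theta> j * (a (j, i) - (\<integral>x. level j x i \<partial>P) / \<theta> j) = \<theta> j * a (j, i) - (\<integral>x. level j x i \<partial>P)"
      using \<theta> by (simp add: right_diff_distrib)
    finally show ?thesis by (simp add: abs_minus_commute)
  qed
  show "\<bar>(\<Sum>i<d. (\<integral>x. level j x i \<partial>P) * s i * hadamard K k i) -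
      2 * 2 ^ j * \<theta> j * (t * a (j, d + k))\<bar> \<le> 4 * 2 ^ j * \<theta> j * (t * \<alpha>)"
    if k: "k < 2 ^ K" for k
  proof -
    define R where "R = 2 * 2 ^ j * \<theta> j"
    have R: "0 < R" using \<theta> by (simp add: R_def)
    have "(\<integral>x. proj s j k x \<partial>P) = (\<Sum>i<d. (\<integral>x. level j x i \<partial>P) / R * hadamard K k i * s i)"
      unfolding proj_def R_def using level_integrable
      by (subst Bochner_Integration.integral_sum) auto
    then have 1: "R * (\<integral>x. proj s j k x \<partial>P) = (\<Sum>i<d. (\<integral>x. level j x i \<partial>P) * s i * hadamard K k i)"
      using R by (simp add: sum_distrib_left mult_ac)
    have "\<bar>a (j, d + k) - (\<integral>x. clip t (proj s j k x) \<partial>P) / t\<bar> \<le> \<alpha>"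
      using a[of "(j, d + k)"] j k by (auto simp: indices_def query_def)
    then have "t * \<bar>a (j, d + k) - (\<integral>x. clip t (proj s j k x) \<partial>P) / t\<bar> \<le> t * \<alpha>"
      using t1 by (intro mult_left_mono) auto
    also have "t * \<bar>a (j, d + k) - (\<integral>x. clip t (proj s j k x) \<partial>P) / t\<bar> =
        \<bar>t * (a (j, d + k) - (\<integral>x. clip t (proj s j k x) \<partial>P) / t)\<bar>"
      using t1 by (simp add: abs_mult)
    also have "t * (a (j, d + k) - (\<integral>x. clip t (proj s j k x) \<partial>P) / t) =
        t * a (j, d + k) - (\<integral>x. clip t (proj s j k x) \<partial>P)"
      using t1 by (simp add: right_diff_distrib)
    finally have 2: "\<bar>t * a (j, d + k) - (\<integral>x. clip t (proj s j k x) \<partial>P)\<bar> \<le> t * \<alpha>" .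
    have "\<bar>(\<integral>x. proj s j k x \<partial>P) - (\<integral>x. clip t (proj s j k x) \<partial>P)\<bar> =
        \<bar>\<integral>x. proj s j k x - clip t (proj s j k x) \<partial>P\<bar>"
      using proj_integrable clip_integrable by (subst Bochner_Integration.integral_diff) auto
    also have "\<dots> \<le> truncation_error s j k"
      unfolding truncation_error_def by (rule integral_abs_bound)
    \<comment> \<open>A good seed bounds the sum of all truncation errors; as they are nonnegative,
      each single one is bounded too.\<close>
    also have "\<dots> \<le> (\<Sum>k<2 ^ K. truncation_error s j k)"
      using k truncation_error_nonneg by (intro member_le_sum) auto
    also have "\<dots> \<le> (\<Sum>j<J. \<Sum>k<2 ^ K. truncation_error s j k)"
      using j truncation_error_nonneg
      by (intro member_le_sum[where f = "\<lambda>j. \<Sum>k<2 ^ K. truncation_error s j k"] sum_nonneg) auto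
    also have "\<dots> \<le> t * \<alpha>" using s by (simp add: good_seeds_def)
    finally have 3: "\<bar>(\<integral>x. proj s j k x \<partial>P) - (\<integral>x. clip t (proj s j k x) \<partial>P)\<bar> \<le> t * \<alpha>" .
    have "\<bar>(\<integral>x. proj s j k x \<partial>P) - t * a (j, d + k)\<bar> \<le> 2 * (t * \<alpha>)"
      using 2 3 by linarith
    then have "R * \<bar>(\<integral>x. proj s j k x \<partial>P) - t * a (j, d + k)\<bar> \<le> R * (2 * (t * \<alpha>))"
      using R by (intro mult_left_mono) auto
    also have "R * \<bar>(\<integral>x. proj s j k x \<partial>P) - t * a (j, d + k)\<bar> =
        \<bar>R * (\<integral>x. proj s j k x \<partial>P) - R * (t * a (j, d + k))\<bar>"
      using R by (simp add: abs_mult right_diff_distrib[symmetric])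
    finally show ?thesis unfolding 1 by (simp add: R_def mult_ac)
  qed
qed

text \<open>The true level means witness that the choice operator selects consistent vectors. Any
  such choice is close to the truth by \<open>consistent_close\<close>, and the levels add up to the
  mean.\<close>

lemma estimate_close:
  assumes s: "s \<in> good_seeds"
    and a: "\<And>p. p \<in> set indices \<Longrightarrow> \<bar>a p - (\<integral>x. query s p x \<partial>P)\<bar> \<le> \<alpha>"
  shows "N (\<lambda>i. estimate s a i - mean P i) \<le> \<epsilon>"
proof -
  define v where "v j = (SOME v. consistent s a j v)" for j
  define \<mu> where "\<mu> j = (\<lambda>i. \<integral>x. level j x i \<partial>P)" for j
  have \<mu>: "consistent s a j (\<mu> j)" if "j < J" for j
    unfolding \<mu>_def using consistent_mean[OF s that] a by blast
  have v: "consistent s a j (v j)" if "j < J" for j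
    unfolding v_def by (rule someI[of "consistent s a j"]) (rule \<mu>[OF that])
  have R: "v j \<in> Rn d" "\<mu> j \<in> Rn d" if "j < J" for j
    using v \<mu> that by (auto simp: consistent_def)
  have "mean P i = (\<Sum>j<J. \<mu> j i)" for i
  proof -
    have "mean P i = (\<integral>x. (\<Sum>j<J. level j x i) \<partial>P)"
      unfolding mean_def using sum_level[OF _ dJ d1]
      by (intro Bochner_Integration.integral_cong) (auto simp: space_P)
    then show ?thesis
      unfolding \<mu>_def using level_integrable by (subst (asm) Bochner_Integration.integral_sum) auto
  qed
  moreover have "estimate s a i = (\<Sum>j<J. v j i)" for i
    using R by (auto simp: estimate_def v_def[symmetric] Rn_def)
  ultimately have "N (\<lambda>i. estimate s a i - mean P i) = N (\<lambda>i. \<Sum>j<J. v j i - \<mu> j i)"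
    by (simp add: sum_subtractf)
  also have "\<dots> \<le> (\<Sum>j<J. N (\<lambda>i. v j i - \<mu> j i))"
    using R by (intro norm_sum_le) (auto simp: Rn_def)
  also have "\<dots> \<le> (\<Sum>j<J. 16 * min T (real d) * (t * \<alpha>))"
    using s v \<mu> by (intro sum_mono consistent_close) (auto simp: good_seeds_def)
  also have "\<dots> \<le> \<epsilon>" using total by simp
  finally show ?thesis .
qed

end

theorem algorithm_correct:
  "mean_estimation_algorithm d N \<epsilon> (J * (d + 2 ^ K)) \<alpha> (measure_pmf (pmf_of_set (signs d))) algorithm"
  unfolding mean_estimation_algorithm_def
proof (intro conjI ballI allI impI)
  show "prob_space (measure_pmf (pmf_of_set (signs d)))" by (rule measure_pmf.prob_space_axioms)
  have "length indices = J * (d + 2 ^ K)" by (simp add: indices_def)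
  moreover have "makes_queries (ball_space d N) (Rn d) (length indices) (algorithm s)" for s
    unfolding algorithm_def
    by (intro makes_queries_ask_all query_stat_query) (auto simp: estimate_def Rn_def)
  ultimately show "makes_queries (ball_space d N) (Rn d) (J * (d + 2 ^ K)) (algorithm s)" for s
    by simp
  fix P orc
  assume P: "prob_space P \<and> sets P = sets (ball_space d N)" and orc: "orc \<in> STAT P \<alpha>"
  have "N (\<lambda>i. run orc (algorithm s) [] i - mean P i) \<le> \<epsilon>" if s: "s \<in> good_seeds P" for s
  proof -
    obtain b where "run orc (algorithm s) [] = estimate s b"
      "\<forall>p\<in>set indices. \<bar>b p - (\<integral>x. query s p x \<partial>P)\<bar> \<le> \<alpha>"
      unfolding algorithm_def
      using run_ask_all[OF orc, of indices "query s"] query_stat_query P by metis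
    then show ?thesis
      using estimate_close[of P s b] P s by simp
  qed
  then show "\<exists>E\<in>sets (measure_pmf (pmf_of_set (signs d))). 2 / 3 \<le> measure_pmf.prob (pmf_of_set (signs d)) E \<and>
      (\<forall>s\<in>E. N (\<lambda>i. run orc (algorithm s) [] i - mean P i) \<le> \<epsilon>)"
    using prob_good_seeds[of P] P by (intro bexI[of _ "good_seeds P"]) auto
qed

end

section \<open>Choice of the parameters\<close>

theorem theorem3p3:
  "\<exists>c::real. c > 0 \<and>
     (\<forall>(d::nat) (N :: vector \<Rightarrow> real) (T::real) (\<epsilon>::real).
        d \<ge> 2 \<and> is_symmetric_norm d N \<and> is_type2_constant d N T \<and> 1 \<le> T \<and>
        N (unit_vector 0) = 1 \<and> 0 < \<epsilon> \<and> \<epsilon> < 1 \<longrightarrow>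
        (\<exists>(\<alpha>::real) (n::nat) R A.
           \<alpha> \<ge> c * (\<epsilon> / (T * log 2 (real d) * log 2 (real d / \<epsilon>))) \<and>
           real n \<le> 3 * real d * log 2 (real d) \<and>
           mean_estimation_algorithm d N \<epsilon> n \<alpha> R A))"
\<comment> \<open>The constant 256 is the 16 in \<open>total\<close> times the 16 in the definition
  of \<open>t\<close>.\<close>
proof (rule exI[of _ "1 / 256 :: real"], intro conjI allI impI)
  fix d :: nat and N :: "vector \<Rightarrow> real" and T \<epsilon> :: real
  assume "d \<ge> 2 \<and> is_symmetric_norm d N \<and> is_type2_constant d N T \<and> 1 \<le> T \<and>
    N (unit_vector 0) = 1 \<and> 0 < \<epsilon> \<and> \<epsilon> < 1"
  then have d: "2 \<le> d" and N: "is_symmetric_norm d N" "N (unit_vector 0) = 1"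
    and T: "type2_inequality d N T" "1 \<le> T" and \<epsilon>: "0 < \<epsilon>" "\<epsilon> < 1"
    by (auto simp: is_type2_constant_def)
  define l where "l = log 2 (real d)"
  \<comment> \<open>The number of exponents \<open>j\<close> with
    \<open>4 ^ j \<le> d\<close>.\<close>
  define J where "J = Suc (nat \<lfloor>log 4 (real d)\<rfloor>)"
  define K where "K = nat \<lceil>l\<rceil>"
  define r where "r = real d / \<epsilon>"
  \<comment> \<open>The factor 16 gives \<open>exp t \<ge> r ^ 16\<close>, a power large enough to
    absorb all polynomial factors in \<open>trunc\<close>.\<close>
  define t where "t = 16 * log 2 r"
  define T' where "T' = min T (real d)"
  \<comment> \<open>Solves \<open>total\<close> with \<open>J\<close> replaced by its upper bound
    \<open>l\<close>.\<close>
  define \<alpha> where "\<alpha> = \<epsilon> / (16 * T' * l * t)"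
  have l1: "1 \<le> l" using d by (simp add: l_def le_log_iff)
  have ld: "l \<le> real d"
    using d of_nat_less_two_power[of d, where 'a = real]
    by (simp add: l_def log_le_iff powr_realpow less_imp_le)
  have log4: "log 4 (real d) = l / 2"
  proof -
    have "ln (4::real) = 2 * ln 2"
      using ln_realpow[of 2 2] by simp
    then show ?thesis by (simp add: l_def log_def)
  qed
  have J4: "real (nat \<lfloor>log 4 (real d)\<rfloor>) = of_int \<lfloor>l / 2\<rfloor>"
  proof -
    have "0 \<le> \<lfloor>l / 2\<rfloor>" using l1 by simp
    then show ?thesis unfolding log4 by (simp only: of_nat_nat)
  qed
  have Jl: "real J \<le> l"
  proof (cases "2 \<le> l")
    case True
    have "of_int \<lfloor>l / 2\<rfloor> \<le> l / 2" by (rule of_int_floor_le)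
    with True J4 show ?thesis by (simp add: J_def)
  next
    \<comment> \<open>Here \<open>d < 4\<close>, so there is a single level, and
      \<open>l \<ge> 1\<close> suffices.\<close>
    case False
    then have "\<lfloor>l / 2\<rfloor> = 0" using l1 by (simp add: floor_eq_iff)
    with l1 J4 show ?thesis by (simp add: J_def)
  qed
  have Jlow: "4 ^ j \<le> d" if "j < J" for j
  proof -
    have "real j \<le> log 4 (real d)"
      using that J4 of_int_floor_le[of "l / 2"] by (simp add: J_def log4 less_Suc_eq_le)
    then have "4 powr (real j) \<le> real d"
      using d by (simp add: le_log_iff)
    then have "real (4 ^ j) \<le> real d" by (simp add: powr_realpow)
    then show ?thesis by (simp only: of_nat_le_iff)
  qed
  have dJ: "d < 4 ^ J"
  proof -
    have "log 4 (real d) < real J"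
      using J4 by (simp add: J_def log4) linarith
    then have "real d < 4 powr real J" using d by (simp add: log_less_iff)
    then have "real d < real (4 ^ J)" by (simp add: powr_realpow)
    then show ?thesis by (simp only: of_nat_less_iff)
  qed
  have "l \<le> real K" "real K < l + 1"
    using l1 unfolding K_def by linarith+
  then have K: "real d \<le> 2 ^ K" "(2::real) ^ K \<le> 2 * real d"
  proof -
    have "2 powr l = real d" using d by (simp add: l_def)
    moreover have "2 powr l \<le> 2 powr real K" "2 powr real K \<le> 2 powr (l + 1)"
      using \<open>l \<le> real K\<close> \<open>real K < l + 1\<close> by (auto intro: powr_mono)
    ultimately show "real d \<le> 2 ^ K" "(2::real) ^ K \<le> 2 * real d"
      by (auto simp: powr_realpow powr_add)
  qed
  have r2: "2 \<le> r"
    using d \<epsilon> by (simp add: r_def le_divide_eq)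
  then have lr: "1 \<le> log 2 r" by (simp add: le_log_iff)
  then have t1: "1 \<le> t" by (simp add: t_def)
  have T': "1 \<le> T'" "T' \<le> T" "T' \<le> real d" using T d by (auto simp: T'_def)
  have pos: "0 < T'" "0 < l" "0 < t" using T' l1 t1 by auto
  have \<alpha>: "0 < \<alpha>" using \<epsilon> T' l1 t1 by (simp add: \<alpha>_def)
  have t\<alpha>: "t * \<alpha> = \<epsilon> / (16 * T' * l)" using t1 by (simp add: \<alpha>_def)
  have r16: "r ^ 16 \<le> exp t"
  proof -
    have "ln r \<le> log 2 r"
    proof -
      have "ln 2 \<le> (1::real)" using ln_2_less_1 by simp
      moreover have "0 \<le> ln r" using r2 by simp
      ultimately show ?thesis by (simp add: log_def le_divide_eq mult_left_le)
    qed
    then have "exp (16 * ln r) \<le> exp t" by (simp add: t_def)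
    moreover have "exp (16 * ln r) = r ^ 16"
      using r2 exp_of_nat_mult[of 16 "ln r"] by simp
    ultimately show ?thesis by simp
  qed
  \<comment> \<open>This begins the proof of \<open>trunc\<close> multiplied by
    \<open>48 * T' * l * exp t\<close>. The factors \<open>J\<close>, \<open>l\<close> and
    \<open>T'\<close> are at most \<open>d\<close>; for \<open>T'\<close> this is due to the minimum
    with \<open>d\<close>.\<close>
  have "real J * 2 ^ K * (288 * T' * l) \<le> real d * (2 * real d) * (288 * real d * real d)"
    using Jl ld K T' l1 by (intro mult_mono) auto
  also have "\<dots> = 576 * real d ^ 4" by (simp add: power4_eq_xxxx)
  also have "\<dots> \<le> \<epsilon> * r ^ 16"
  proof -
    \<comment> \<open>Twelve powers of \<open>r\<close> pay for the constant 576; the other four,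
      with the factor \<open>\<epsilon>\<close>, pay for \<open>d ^ 4\<close>.\<close>
    have "2 ^ 12 \<le> r ^ 12" using r2 by (intro power_mono) auto
    moreover have "real d ^ 4 \<le> \<epsilon> * r ^ 4"
    proof -
      have "\<epsilon> * r ^ 4 = real d ^ 4 * (\<epsilon> / \<epsilon> ^ 4)" by (simp add: r_def power_divide)
      moreover have "1 \<le> \<epsilon> / \<epsilon> ^ 4"
        using \<epsilon> power_decreasing[of 1 4 \<epsilon>] by (simp add: le_divide_eq)
      ultimately show ?thesis
        using mult_left_mono[of 1 "\<epsilon> / \<epsilon> ^ 4" "real d ^ 4"] by simp
    qed
    ultimately have "2 ^ 12 * real d ^ 4 \<le> r ^ 12 * (\<epsilon> * r ^ 4)"
      using r2 by (intro mult_mono zero_le_power) simp_all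
    moreover have "r ^ 12 * (\<epsilon> * r ^ 4) = \<epsilon> * r ^ 16"
    proof -
      have "r ^ 16 = r ^ 12 * r ^ 4" by (simp flip: power_add)
      then show ?thesis by (simp only: mult_ac)
    qed
    ultimately have "2 ^ 12 * real d ^ 4 \<le> \<epsilon> * r ^ 16" by simp
    moreover have "576 * real d ^ 4 \<le> 2 ^ 12 * real d ^ 4" by simp
    ultimately show ?thesis by linarith
  qed
  also have "\<dots> \<le> \<epsilon> * exp t" using r16 \<epsilon> by simp
  finally have "real J * 2 ^ K * (288 * T' * l) / (48 * T' * l * exp t) \<le> \<epsilon> * exp t / (48 * T' * l * exp t)"
    using pos by (intro divide_right_mono) simp_all
  moreover have "real J * 2 ^ K * (288 * T' * l) / (48 * T' * l * exp t) = real J * 2 ^ K * (6 * exp (- t))"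
    using pos by (simp add: exp_minus divide_simps)
  moreover have "\<epsilon> * exp t / (48 * T' * l * exp t) = t * \<alpha> / 3"
    using pos unfolding t\<alpha> by simp
  ultimately have trunc: "real J * 2 ^ K * (6 * exp (- t)) \<le> t * \<alpha> / 3"
    by (simp only:)
  have total: "real J * (16 * min T (real d) * (t * \<alpha>)) \<le> \<epsilon>"
  proof -
    have "real J * (16 * min T (real d) * (t * \<alpha>)) = \<epsilon> * (real J / l)"
      using pos unfolding t\<alpha> T'_def[symmetric] by simp
    also have "\<dots> \<le> \<epsilon> * 1" using Jl l1 \<epsilon> by (intro mult_left_mono) auto
    finally show ?thesis by simp
  qed
  interpret sq_mean_estimation d N K J t \<alpha> T \<epsilon>
  proof
    have "real d \<le> real (2 ^ K)" using K by simp
    then show "d \<le> 2 ^ K" by (simp only: of_nat_le_iff)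
  qed (use d N T \<epsilon> t1 \<alpha> Jlow dJ trunc total in auto)
  show "\<exists>(\<alpha>::real) (n::nat) R A.
      \<alpha> \<ge> 1 / 256 * (\<epsilon> / (T * log 2 (real d) * log 2 (real d / \<epsilon>))) \<and>
      real n \<le> 3 * real d * log 2 (real d) \<and> mean_estimation_algorithm d N \<epsilon> n \<alpha> R A"
  proof (intro exI conjI)
    show "mean_estimation_algorithm d N \<epsilon> (J * (d + 2 ^ K)) \<alpha> (measure_pmf (pmf_of_set (signs d))) algorithm"
      by (rule algorithm_correct)
    have "real (J * (d + 2 ^ K)) \<le> l * (3 * real d)"
      using Jl K l1 unfolding of_nat_mult by (intro mult_mono) auto
    then show "real (J * (d + 2 ^ K)) \<le> 3 * real d * log 2 (real d)"
      by (simp add: l_def mult_ac)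
    have "1 / 256 * (\<epsilon> / (T * l * log 2 r)) = \<epsilon> / (16 * T * l * t)"
      by (simp add: t_def)
    also have "\<dots> \<le> \<alpha>"
      unfolding \<alpha>_def using pos T'(2) \<epsilon>(1)
      by (intro divide_left_mono mult_right_mono mult_left_mono mult_pos_pos) auto
    finally show "\<alpha> \<ge> 1 / 256 * (\<epsilon> / (T * log 2 (real d) * log 2 (real d / \<epsilon>)))"
      by (simp add: l_def r_def)
  qed
qed simp

end
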